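(* Let $(X,\tau)$ be a fundamental extended locally convex space such that $X=X_{fin}\oplus M$ (algebraic direct sum, $M$ a linear subspace). Then $\tau_{ucb}=\tau_s$ on $X^*$.
   Context: Vector spaces are over $\mathbb{K}$, where $\mathbb{K}$ is $\mathbb{R}$ or $\mathbb{C}$. An extended seminorm on $X$ is a map $\rho:X\to[0,\infty]$ with $\rho(\alpha x)=|\alpha|\rho(x)$ (convention $0\cdot\infty=0$) and $\rho(x+y)\le\rho(x)+\rho(y)$. An extended locally convex space (elcs) is a vector space $X$ with a group topology $\tau$ induced by a family $\{\rho_i\}_{i\in I}$ of extended seminorms, i.e. the sets $\{y:\rho_i(y-x)<\varepsilon \text{ for all } i\in J\}$ with $\varepsilon>0$ and $J\subseteq I$ finite form a neighborhood base at $x$. $S(X,\tau)$ is the set of all continuous extended seminorms on $(X,\tau)$; for $\rho\in S(X,\tau)$, $X_{fin}^\rho=\{x\in X:\rho(x)<\infty\}$; and $X_{fin}=\bigcap_{\rho\in S(X,\tau)}X_{fin}^\rho$. The elcs is fundamental if $X_{fin}=X_{fin}^\rho$ for some $\rho\in S(X,\tau)$. $X^*$ is the set of all $\tau$-continuous linear functionals $X\to\mathbb{K}$. The finest locally convex topology (flc topology) $\tau_F$ is the finest locally convex topology on $X$ (i.e. one induced by finite-valued seminorms) that is coarser than $\tau$; one has $(X,\tau_F)^*=X^*$. A set $A\subseteq X$ is bounded in an elcs $(X,\tau)$ if for every neighborhood $U$ of $0$ there exist $r>0$ and a finite set $F\subseteq A$ such that $A\subseteq F+rU$; bounded sets in the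 locally convex space $(X,\tau_F)$ are bounded in the usual sense. $\tau_{ucb}$ is the topology on $X^*$ induced by the seminorms $f\mapsto\sup_{x\in B}|f(x)|$ with $B$ bounded in $(X,\tau)$; $\tau_s$ is the topology on $X^*$ induced by the same kind of seminorms with $B$ bounded in $(X,\tau_F)$. *)

theory Defs
  imports "HOL-Analysis.Analysis"
begin

text \<open>
  The scalar fields: \<open>\<real>\<close> and \<open>\<complex>\<close>, up to isometric isomorphism. The norm is multiplicative and
  extends the absolute value of \<open>\<real>\<close>, so in the second case it is the usual modulus.
\<close>

class real_or_complex = real_normed_field +
  assumes real_or_complex:
    "(\<forall>z::'a. \<exists>a. z = a *\<^sub>R 1) \<or>
     (\<exists>i::'a. i * i = - 1 \<and> (\<forall>z. \<exists>a b. z = a *\<^sub>R 1 + b *\<^sub>R i))"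

instance real :: real_or_complex
  by standard auto

instance complex :: real_or_complex
proof
  have "z = Re z *\<^sub>R 1 + Im z *\<^sub>R \<i>" for z
    by (simp add: complex_eq_iff)
  then have "\<i> * \<i> = - 1 \<and> (\<forall>z. \<exists>a b. z = a *\<^sub>R 1 + b *\<^sub>R \<i>)"
    using i_squared by blast
  then show "(\<forall>z::complex. \<exists>a. z = a *\<^sub>R 1) \<or>
     (\<exists>i::complex. i * i = - 1 \<and> (\<forall>z. \<exists>a b. z = a *\<^sub>R 1 + b *\<^sub>R i))"
    by (intro disjI2 exI[of _ \<i>])
qed

text \<open>In \<^typ>\<open>ennreal\<close> we have \<open>0 * \<infinity> = 0\<close>.\<close>

definition ext_seminorm ::
  "('k::real_or_complex \<Rightarrow> 'a::ab_group_add \<Rightarrow> 'a) \<Rightarrow> ('a \<Rightarrow> ennreal) \<Rightarrow> bool" where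
  "ext_seminorm smul \<rho> \<longleftrightarrow>
     (\<forall>\<alpha> x. \<rho> (smul \<alpha> x) = ennreal (norm \<alpha>) * \<rho> x) \<and>
     (\<forall>x y. \<rho> (x + y) \<le> \<rho> x + \<rho> y)"

text \<open>
  The topology on the carrier \<open>V\<close> in which the sets
  \<open>{y \<in> V. \<forall>\<rho>\<in>J. \<rho> (y - x) < \<epsilon>}\<close>, \<open>J \<subseteq> P\<close> finite and \<open>\<epsilon> > 0\<close>, form a neighbourhood base at \<open>x\<close>.
  (This is meant for \<open>P\<close> consisting of extended seminorms; these sets are then themselves open.)
\<close>

definition seminorm_topology :: "'b::minus set \<Rightarrow> ('b \<Rightarrow> ennreal) set \<Rightarrow> 'b topology" where
  "seminorm_topology V P = topology (\<lambda>U. U \<subseteq> V \<and>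
     (\<forall>x\<in>U. \<exists>J \<epsilon>. finite J \<and> J \<subseteq> P \<and> (\<epsilon>::real) > 0 \<and>
        {y \<in> V. \<forall>\<rho>\<in>J. \<rho> (y - x) < ennreal \<epsilon>} \<subseteq> U))"

lemma openin_seminorm_topology:
  "openin (seminorm_topology V P) U \<longleftrightarrow> U \<subseteq> V \<and>
     (\<forall>x\<in>U. \<exists>J \<epsilon>. finite J \<and> J \<subseteq> P \<and> (\<epsilon>::real) > 0 \<and>
        {y \<in> V. \<forall>\<rho>\<in>J. \<rho> (y - x) < ennreal \<epsilon>} \<subseteq> U)"
proof -
  define N where "N U x \<longleftrightarrow> (\<exists>J \<epsilon>. finite J \<and> J \<subseteq> P \<and> (\<epsilon>::real) > 0 \<and>
        {y \<in> V. \<forall>\<rho>\<in>J. \<rho> (y - x) < ennreal \<epsilon>} \<subseteq> U)" for U x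
  have mono: "N T x" if S: "N S x" and sub: "S \<subseteq> T" for S T x
  proof -
    obtain J and e :: real where "finite J" "J \<subseteq> P" "e > 0"
      "{y \<in> V. \<forall>\<rho>\<in>J. \<rho> (y - x) < ennreal e} \<subseteq> S"
      using S unfolding N_def by blast
    then have "{y \<in> V. \<forall>\<rho>\<in>J. \<rho> (y - x) < ennreal e} \<subseteq> T"
      using sub by (meson order_trans)
    then show ?thesis
      using \<open>finite J\<close> \<open>J \<subseteq> P\<close> \<open>e > 0\<close> unfolding N_def by blast
  qed
  have inter: "N (S \<inter> T) x" if S: "N S x" and T: "N T x" for S T x
  proof -
    obtain J and e :: real where J: "finite J" "J \<subseteq> P" "e > 0"
      "{y \<in> V. \<forall>\<rho>\<in>J. \<rho> (y - x) < ennreal e} \<subseteq> S"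
      using S unfolding N_def by blast
    obtain K and d :: real where K: "finite K" "K \<subseteq> P" "d > 0"
      "{y \<in> V. \<forall>\<rho>\<in>K. \<rho> (y - x) < ennreal d} \<subseteq> T"
      using T unfolding N_def by blast
    have le: "ennreal (min e d) \<le> ennreal e" "ennreal (min e d) \<le> ennreal d"
      by (auto intro: ennreal_leI)
    have "{y \<in> V. \<forall>\<rho>\<in>J \<union> K. \<rho> (y - x) < ennreal (min e d)} \<subseteq> S \<inter> T"
    proof
      fix y assume y: "y \<in> {y \<in> V. \<forall>\<rho>\<in>J \<union> K. \<rho> (y - x) < ennreal (min e d)}"
      then have "\<forall>\<rho>\<in>J. \<rho> (y - x) < ennreal e" "\<forall>\<rho>\<in>K. \<rho> (y - x) < ennreal d"
        using le by (auto intro: less_le_trans)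
      then show "y \<in> S \<inter> T"
        using y J(4) K(4) by blast
    qed
    moreover have "finite (J \<union> K)" "J \<union> K \<subseteq> P" "min e d > 0"
      using J K by auto
    ultimately show ?thesis unfolding N_def by blast
  qed
  have "istopology (\<lambda>U. U \<subseteq> V \<and> (\<forall>x\<in>U. N U x))"
    unfolding istopology_def
  proof (intro conjI allI impI)
    fix S T assume A: "S \<subseteq> V \<and> (\<forall>x\<in>S. N S x)" and B: "T \<subseteq> V \<and> (\<forall>x\<in>T. N T x)"
    show "S \<inter> T \<subseteq> V" using A by blast
    show "\<forall>x\<in>S \<inter> T. N (S \<inter> T) x"
    proof
      fix x assume "x \<in> S \<inter> T"
      then have "N S x" "N T x" using A B by blast+
      then show "N (S \<inter> T) x" by (rule inter)
    qed
  next
    fix \<K> assume K: "\<forall>S\<in>\<K>. S \<subseteq> V \<and> (\<forall>x\<in>S. N S x)"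
    show "\<Union>\<K> \<subseteq> V" using K by blast
    show "\<forall>x\<in>\<Union>\<K>. N (\<Union>\<K>) x"
    proof
      fix x assume "x \<in> \<Union>\<K>"
      then obtain S where "S \<in> \<K>" "x \<in> S" by blast
      then have "N S x" "S \<subseteq> \<Union>\<K>" using K by blast+
      then show "N (\<Union>\<K>) x" by (rule mono)
    qed
  qed
  then show ?thesis
    unfolding seminorm_topology_def N_def by (simp only: topology_inverse')
qed

definition elcs ::
  "('k::real_or_complex \<Rightarrow> 'a::ab_group_add \<Rightarrow> 'a) \<Rightarrow> 'a topology \<Rightarrow> bool" where
  "elcs smul \<tau> \<longleftrightarrow> vector_space smul \<and>
     (\<exists>P. (\<forall>\<rho>\<in>P. ext_seminorm smul \<rho>) \<and> \<tau> = seminorm_topology UNIV P)"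

definition locally_convex_topology ::
  "('k::real_or_complex \<Rightarrow> 'a::ab_group_add \<Rightarrow> 'a) \<Rightarrow> 'a topology \<Rightarrow> bool" where
  "locally_convex_topology smul \<tau> \<longleftrightarrow>
     (\<exists>P. (\<forall>\<rho>\<in>P. ext_seminorm smul \<rho> \<and> (\<forall>x. \<rho> x < \<infinity>)) \<and> \<tau> = seminorm_topology UNIV P)"

text \<open>
  Continuity refers to the usual (order) topology of \<open>[0, \<infinity>]\<close>; for an extended seminorm on an
  extended locally convex space it amounts to continuity at \<open>0\<close>, since then \<open>{x. \<rho> x = \<infinity>}\<close> is open.
\<close>

definition cont_ext_seminorms ::
  "('k::real_or_complex \<Rightarrow> 'a::ab_group_add \<Rightarrow> 'a) \<Rightarrow> 'a topology \<Rightarrow> ('a \<Rightarrow> ennreal) set" where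
  "cont_ext_seminorms smul \<tau> = {\<rho>. ext_seminorm smul \<rho> \<and> continuous_map \<tau> euclidean \<rho>}"

definition fin_part :: "('a \<Rightarrow> ennreal) \<Rightarrow> 'a set" where
  "fin_part \<rho> = {x. \<rho> x < \<infinity>}"

definition fin_subspace ::
  "('k::real_or_complex \<Rightarrow> 'a::ab_group_add \<Rightarrow> 'a) \<Rightarrow> 'a topology \<Rightarrow> 'a set" where
  "fin_subspace smul \<tau> = (\<Inter>\<rho>\<in>cont_ext_seminorms smul \<tau>. fin_part \<rho>)"

definition fundamental ::
  "('k::real_or_complex \<Rightarrow> 'a::ab_group_add \<Rightarrow> 'a) \<Rightarrow> 'a topology \<Rightarrow> bool" where
  "fundamental smul \<tau> \<longleftrightarrow>
     (\<exists>\<rho>\<in>cont_ext_seminorms smul \<tau>. fin_subspace smul \<tau> = fin_part \<rho>)"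

definition top_dual ::
  "('k::real_or_complex \<Rightarrow> 'a::ab_group_add \<Rightarrow> 'a) \<Rightarrow> 'a topology \<Rightarrow> ('a \<Rightarrow> 'k) set" where
  "top_dual smul \<tau> =
     {f. Vector_Spaces.linear smul (*) f \<and> continuous_map \<tau> euclidean f}"

definition coarser :: "'a topology \<Rightarrow> 'a topology \<Rightarrow> bool" where
  "coarser \<sigma> \<tau> \<longleftrightarrow> (\<forall>U. openin \<sigma> U \<longrightarrow> openin \<tau> U)"

definition is_flc_topology ::
  "('k::real_or_complex \<Rightarrow> 'a::ab_group_add \<Rightarrow> 'a) \<Rightarrow> 'a topology \<Rightarrow> 'a topology \<Rightarrow> bool" where
  "is_flc_topology smul \<tau> \<sigma> \<longleftrightarrow>
     locally_convex_topology smul \<sigma> \<and> coarser \<sigma> \<tau> \<and>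
     (\<forall>\<sigma>'. locally_convex_topology smul \<sigma>' \<and> coarser \<sigma>' \<tau> \<longrightarrow> coarser \<sigma>' \<sigma>)"

definition flc_topology ::
  "('k::real_or_complex \<Rightarrow> 'a::ab_group_add \<Rightarrow> 'a) \<Rightarrow> 'a topology \<Rightarrow> 'a topology" where
  "flc_topology smul \<tau> = (THE \<sigma>. is_flc_topology smul \<tau> \<sigma>)"

definition nhd_zero :: "'a::zero topology \<Rightarrow> 'a set \<Rightarrow> bool" where
  "nhd_zero \<tau> U \<longleftrightarrow> (\<exists>V. openin \<tau> V \<and> 0 \<in> V \<and> V \<subseteq> U)"

definition elcs_bounded ::
  "('k::real_or_complex \<Rightarrow> 'a::ab_group_add \<Rightarrow> 'a) \<Rightarrow> 'a topology \<Rightarrow> 'a set \<Rightarrow> bool" where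
  "elcs_bounded smul \<tau> A \<longleftrightarrow>
     (\<forall>U. nhd_zero \<tau> U \<longrightarrow> (\<exists>(r::real) F. r > 0 \<and> finite F \<and> F \<subseteq> A \<and>
        A \<subseteq> {x + smul (of_real r) u | x u. x \<in> F \<and> u \<in> U}))"

definition lcs_bounded ::
  "('k::real_or_complex \<Rightarrow> 'a::ab_group_add \<Rightarrow> 'a) \<Rightarrow> 'a topology \<Rightarrow> 'a set \<Rightarrow> bool" where
  "lcs_bounded smul \<tau> A \<longleftrightarrow>
     (\<forall>U. nhd_zero \<tau> U \<longrightarrow> (\<exists>r::real. r > 0 \<and> A \<subseteq> smul (of_real r) ` U))"

text \<open>For \<open>B = {}\<close> the supremum is \<open>0\<close>.\<close>

definition sup_seminorm :: "'a set \<Rightarrow> ('a \<Rightarrow> 'k::real_or_complex) \<Rightarrow> ennreal" where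
  "sup_seminorm B f = (SUP x\<in>B. ennreal (norm (f x)))"

definition ucb_topology ::
  "('k::real_or_complex \<Rightarrow> 'a::ab_group_add \<Rightarrow> 'a) \<Rightarrow> 'a topology \<Rightarrow> ('a \<Rightarrow> 'k) topology" where
  "ucb_topology smul \<tau> =
     seminorm_topology (top_dual smul \<tau>) (sup_seminorm ` {B. elcs_bounded smul \<tau> B})"

definition strong_topology ::
  "('k::real_or_complex \<Rightarrow> 'a::ab_group_add \<Rightarrow> 'a) \<Rightarrow> 'a topology \<Rightarrow> ('a \<Rightarrow> 'k) topology" where
  "strong_topology smul \<tau> =
     seminorm_topology (top_dual smul \<tau>)
       (sup_seminorm ` {B. lcs_bounded smul (flc_topology smul \<tau>) B})"

text \<open>The definite description in \<^const>\<open>flc_topology\<close> is proper.\<close>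

lemma continuous_map_seminorm_topology:
  fixes smul :: "'k::real_or_complex \<Rightarrow> 'a::ab_group_add \<Rightarrow> 'a"
  assumes ext: "ext_seminorm smul \<rho>" and fin: "\<And>x. \<rho> x < \<infinity>" and mem: "\<rho> \<in> R"
    and vs: "vector_space smul"
  shows "continuous_map (seminorm_topology UNIV R) euclidean \<rho>"
proof -
  interpret vector_space smul by (rule vs)
  define r where "r = (\<lambda>x. enn2real (\<rho> x))"
  have rho: "\<rho> x = ennreal (r x)" for x
    using fin[of x] by (simp add: r_def)
  have r0: "r x \<ge> 0" for x by (simp add: r_def)
  have tri: "r (x + y) \<le> r x + r y" for x y
  proof -
    have "\<rho> (x + y) \<le> \<rho> x + \<rho> y" using ext by (simp add: ext_seminorm_def)
    then have "ennreal (r (x + y)) \<le> ennreal (r x + r y)"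
      by (simp add: rho r0)
    then show ?thesis by (subst (asm) ennreal_le_iff) (auto simp: r0)
  qed
  have neg: "r (- x) = r x" for x
  proof -
    have "\<rho> (smul (- 1) x) = ennreal (norm (- 1 :: 'k)) * \<rho> x"
      using ext unfolding ext_seminorm_def by blast
    then have "\<rho> (- x) = \<rho> x" by simp
    then show ?thesis by (simp add: r_def)
  qed
  have lip: "\<bar>r y - r x\<bar> \<le> r (y - x)" for x y
    using tri[of "y - x" x] tri[of "x - y" y] neg[of "x - y"] by simp
  have "continuous_map (seminorm_topology UNIV R) euclidean r"
    unfolding continuous_map_def
  proof (intro conjI allI impI)
    fix W :: "real set" assume "openin euclidean W"
    then have W: "open W" by simp
    have top: "topspace (seminorm_topology UNIV R) = UNIV"
    proof -
      have "openin (seminorm_topology UNIV R) UNIV"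
        unfolding openin_seminorm_topology
        by (auto intro!: exI[of _ "{}"] exI[of _ "1::real"])
      then show ?thesis using openin_subset by blast
    qed
    show "openin (seminorm_topology UNIV R)
            {x \<in> topspace (seminorm_topology UNIV R). r x \<in> W}"
      unfolding openin_seminorm_topology top
    proof (intro conjI ballI)
      fix x assume "x \<in> {x \<in> UNIV. r x \<in> W}"
      then obtain e where e: "e > 0" "\<And>z. dist z (r x) < e \<Longrightarrow> z \<in> W"
        using W by (auto simp: open_dist)
      have "{y \<in> UNIV. \<forall>\<rho>\<in>{\<rho>}. \<rho> (y - x) < ennreal e} \<subseteq> {x \<in> UNIV. r x \<in> W}"
      proof
        fix y assume "y \<in> {y \<in> UNIV. \<forall>\<rho>\<in>{\<rho>}. \<rho> (y - x) < ennreal e}"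
        then have "r (y - x) < e" by (simp add: rho r0 ennreal_less_iff)
        then have "dist (r y) (r x) < e" using lip[of y x] by (simp add: dist_real_def)
        then show "y \<in> {x \<in> UNIV. r x \<in> W}" using e by blast
      qed
      then show "\<exists>J \<epsilon>. finite J \<and> J \<subseteq> R \<and> 0 < \<epsilon> \<and>
          {y \<in> UNIV. \<forall>\<rho>\<in>J. \<rho> (y - x) < ennreal \<epsilon>} \<subseteq> {x \<in> UNIV. r x \<in> W}"
        using e(1) mem by (intro exI[of _ "{\<rho>}"] exI[of _ e]) auto
    qed auto
  qed auto
  moreover have "continuous_map euclidean euclidean ennreal"
    by (simp add: continuous_on_ennreal continuous_on_id)
  ultimately have "continuous_map (seminorm_topology UNIV R) euclidean (ennreal \<circ> r)"
    by (rule continuous_map_compose)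
  then show ?thesis by (simp add: o_def rho[symmetric])
qed

lemma is_flc_topology_flc_topology:
  fixes smul :: "'k::real_or_complex \<Rightarrow> 'a::ab_group_add \<Rightarrow> 'a"
  assumes "elcs smul \<tau>"
  shows "is_flc_topology smul \<tau> (flc_topology smul \<tau>)"
proof -
  obtain Q where vs: "vector_space smul" and tau: "\<tau> = seminorm_topology UNIV Q"
    using assms by (auto simp: elcs_def)
  interpret vector_space smul by (rule vs)
  define P where "P = {\<rho>. (ext_seminorm smul \<rho> \<and> (\<forall>x. \<rho> x < \<infinity>)) \<and>
    continuous_map \<tau> euclidean \<rho>}"
  define \<sigma> where "\<sigma> = seminorm_topology UNIV P"
  have top: "topspace \<tau> = UNIV"
  proof -
    have "openin \<tau> UNIV"
      unfolding openin_seminorm_topology tau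
      by (auto intro!: exI[of _ "{}"] exI[of _ "1::real"])
    then show ?thesis using openin_subset by blast
  qed
  have trans: "openin \<tau> {y. y - x \<in> U}" if U: "openin \<tau> U" for U x
    unfolding tau openin_seminorm_topology
  proof (intro conjI ballI)
    fix y assume "y \<in> {y. y - x \<in> U}"
    then obtain J and e :: real where J: "finite J" "J \<subseteq> Q" "e > 0"
      "{z \<in> UNIV. \<forall>\<rho>\<in>J. \<rho> (z - (y - x)) < ennreal e} \<subseteq> U"
      using U unfolding tau openin_seminorm_topology by blast
    have "{z \<in> UNIV. \<forall>\<rho>\<in>J. \<rho> (z - y) < ennreal e} \<subseteq> {y. y - x \<in> U}"
    proof
      fix z assume "z \<in> {z \<in> UNIV. \<forall>\<rho>\<in>J. \<rho> (z - y) < ennreal e}"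
      then have "z - x \<in> {z \<in> UNIV. \<forall>\<rho>\<in>J. \<rho> (z - (y - x)) < ennreal e}" by simp
      then show "z \<in> {y. y - x \<in> U}" using J(4) by blast
    qed
    then show "\<exists>J \<epsilon>. finite J \<and> J \<subseteq> Q \<and> 0 < \<epsilon> \<and>
        {z \<in> UNIV. \<forall>\<rho>\<in>J. \<rho> (z - y) < ennreal \<epsilon>} \<subseteq> {y. y - x \<in> U}"
      using J by blast
  qed auto
  have "locally_convex_topology smul \<sigma>"
    unfolding locally_convex_topology_def
    by (rule exI[of _ P]) (simp add: \<sigma>_def P_def)
  moreover have "coarser \<sigma> \<tau>"
    unfolding coarser_def
  proof (intro allI impI)
    fix U assume U: "openin \<sigma> U"
    show "openin \<tau> U"
      unfolding openin_subopen[of \<tau> U]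
    proof
      fix x assume "x \<in> U"
      then obtain J and e :: real where J: "finite J" "J \<subseteq> P" "e > 0"
        "{y \<in> UNIV. \<forall>\<rho>\<in>J. \<rho> (y - x) < ennreal e} \<subseteq> U"
        using U unfolding \<sigma>_def openin_seminorm_topology by blast
      have one: "openin \<tau> {y. \<rho> (y - x) < ennreal e}" if "\<rho> \<in> J" for \<rho>
      proof -
        have "continuous_map \<tau> euclidean \<rho>" using that J(2) by (auto simp: P_def)
        then have "openin \<tau> {y \<in> topspace \<tau>. \<rho> y \<in> {..<ennreal e}}"
          by (rule openin_continuous_map_preimage) auto
        then have "openin \<tau> {y. \<rho> y < ennreal e}" by (simp add: top)
        from trans[OF this, of x] show ?thesis by simp
      qed
      have zero: "\<rho> 0 = 0" if "\<rho> \<in> J" for \<rho>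
      proof -
        have "ext_seminorm smul \<rho>" using that J(2) by (auto simp: P_def)
        then have "\<rho> (smul 0 0) = ennreal (norm (0::'k)) * \<rho> 0"
          unfolding ext_seminorm_def by blast
        then show ?thesis by simp
      qed
      have "openin \<tau> (topspace \<tau> \<inter> (\<Inter>\<rho>\<in>J. {y. \<rho> (y - x) < ennreal e}))"
        using J(1) one by (cases "J = {}") (auto intro!: openin_Int)
      moreover have "topspace \<tau> \<inter> (\<Inter>\<rho>\<in>J. {y. \<rho> (y - x) < ennreal e}) \<subseteq> U"
        using J(4) by auto
      moreover have "x \<in> topspace \<tau> \<inter> (\<Inter>\<rho>\<in>J. {y. \<rho> (y - x) < ennreal e})"
        using J(3) by (simp add: top zero)
      ultimately show "\<exists>T. openin \<tau> T \<and> x \<in> T \<and> T \<subseteq> U" by blast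
    qed
  qed
  moreover have "coarser \<sigma>' \<sigma>"
    if lc: "locally_convex_topology smul \<sigma>'" and co: "coarser \<sigma>' \<tau>" for \<sigma>'
  proof -
    obtain R where R: "\<forall>\<rho>\<in>R. ext_seminorm smul \<rho> \<and> (\<forall>x. \<rho> x < \<infinity>)"
      and s: "\<sigma>' = seminorm_topology UNIV R"
      using lc by (auto simp: locally_convex_topology_def)
    have top': "topspace \<sigma>' = UNIV"
    proof -
      have "openin \<sigma>' UNIV"
        unfolding openin_seminorm_topology s
        by (auto intro!: exI[of _ "{}"] exI[of _ "1::real"])
      then show ?thesis using openin_subset by blast
    qed
    have "R \<subseteq> P"
    proof
      fix \<rho> assume r: "\<rho> \<in> R"
      have "continuous_map \<sigma>' euclidean \<rho>"
        unfolding s using R r by (intro continuous_map_seminorm_topology[OF _ _ r vs]) auto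
      then have "continuous_map \<tau> euclidean \<rho>"
        using co by (auto simp: continuous_map_def top top' coarser_def)
      then show "\<rho> \<in> P" using R r by (auto simp: P_def)
    qed
    have "openin \<sigma> U" if U: "openin \<sigma>' U" for U
      unfolding \<sigma>_def openin_seminorm_topology
    proof (intro conjI ballI)
      fix x assume "x \<in> U"
      then obtain J and e :: real where J: "finite J" "J \<subseteq> R" "e > 0"
        "{y \<in> UNIV. \<forall>\<rho>\<in>J. \<rho> (y - x) < ennreal e} \<subseteq> U"
        using U unfolding s openin_seminorm_topology by blast
      show "\<exists>J \<epsilon>. finite J \<and> J \<subseteq> P \<and> 0 < \<epsilon> \<and>
          {y \<in> UNIV. \<forall>\<rho>\<in>J. \<rho> (y - x) < ennreal \<epsilon>} \<subseteq> U"
        by (rule exI[of _ J], rule exI[of _ e]) (use J \<open>R \<subseteq> P\<close> in simp)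
    qed simp
    then show ?thesis by (simp add: coarser_def)
  qed
  ultimately have flc: "is_flc_topology smul \<tau> \<sigma>"
    by (simp add: is_flc_topology_def)
  show ?thesis
    unfolding flc_topology_def
  proof (rule theI[where P = "is_flc_topology smul \<tau>" and a = \<sigma>])
    show "is_flc_topology smul \<tau> \<sigma>" by (rule flc)
  next
    fix \<sigma>' assume "is_flc_topology smul \<tau> \<sigma>'"
    then show "\<sigma>' = \<sigma>"
      using flc unfolding is_flc_topology_def coarser_def topology_eq by blast
  qed
qed

end

theory Submission imports Defs begin

text \<open>
  Every \<open>\<tau>\<close>-bounded set is \<open>\<tau>\<^sub>F\<close>-bounded, because the finitely many translates that the definition
  of boundedness allows cost only a constant when the seminorms are finite
  (\<open>elcs_bounded_imp_lcs_bounded_flc\<close>). Hence \<open>\<tau>\<^sub>s\<close> is finer than \<open>\<tau>\<^sub>u\<^sub>c\<^sub>b\<close>.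

  For the converse it suffices that each seminorm \<open>sup\<^sub>B \<bar>f\<bar>\<close> with \<open>B\<close> bounded for \<open>\<tau>\<^sub>F\<close> is dominated by
  a multiple of \<open>sup\<^sub>B\<^sub>' \<bar>f\<bar>\<close> for some \<open>\<tau>\<close>-bounded \<open>B'\<close> (\<open>lcs_bounded_flc_dominated\<close>).
  Since \<open>\<tau>\<close> is fundamental, \<open>X\<^sub>f\<^sub>i\<^sub>n\<close> is \<open>\<tau>\<close>-open. Let \<open>p\<close> be the projection onto \<open>X\<^sub>f\<^sub>i\<^sub>n\<close> along \<open>M\<close>. Two kinds
  of finite seminorms are \<open>\<tau>\<close>-continuous, and therefore bounded on \<open>B\<close>
  (\<open>lcs_bounded_flc_imp_bounded\<close>):

  \<^item> \<open>\<rho> \<circ> p\<close> for a continuous extended seminorm \<open>\<rho>\<close>: it agrees with \<open>\<rho>\<close> on the open set \<open>X\<^sub>f\<^sub>i\<^sub>n\<close>.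
    So \<open>p(B)\<close> is \<open>\<tau>\<close>-bounded.
  \<^item> \<open>x \<mapsto> \<bar>g (x - p x)\<bar>\<close> for an arbitrary linear functional \<open>g\<close>: it vanishes on \<open>X\<^sub>f\<^sub>i\<^sub>n\<close>. So every linear
    functional is bounded on \<open>(id - p)(B)\<close>, which forces this set to lie in the span of a finite set
    \<open>E\<close>, with bounded coefficients (\<open>bounded_functionals_imp_finite_dim\<close>).

  As finite sets are harmless for \<open>\<tau>\<close>-boundedness, \<open>B' = p(B) \<union> E \<union> {0}\<close> is \<open>\<tau>\<close>-bounded, and splitting
  \<open>f b = f (p b) + f (b - p b)\<close> gives the domination.
\<close>

section \<open>Extended seminorms and their topologies\<close>

lemma ext_seminorm_scale:
  "ext_seminorm smul \<rho> \<Longrightarrow> \<rho> (smul \<alpha> x) = ennreal (norm \<alpha>) * \<rho> x"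
  by (simp add: ext_seminorm_def)

lemma ext_seminorm_triangle:
  "ext_seminorm smul \<rho> \<Longrightarrow> \<rho> (x + y) \<le> \<rho> x + \<rho> y"
  by (simp add: ext_seminorm_def)

lemma ext_seminorm_zero:
  fixes smul :: "'k::real_or_complex \<Rightarrow> 'a::ab_group_add \<Rightarrow> 'a"
  assumes "vector_space smul" "ext_seminorm smul \<rho>"
  shows "\<rho> 0 = 0"
proof -
  interpret vector_space smul by fact
  show ?thesis using ext_seminorm_scale[OF assms(2), of 0 0] by simp
qed

lemma ext_seminorm_minus:
  fixes smul :: "'k::real_or_complex \<Rightarrow> 'a::ab_group_add \<Rightarrow> 'a"
  assumes "vector_space smul" "ext_seminorm smul \<rho>"
  shows "\<rho> (- x) = \<rho> x"
proof -
  interpret vector_space smul by fact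
  show ?thesis using ext_seminorm_scale[OF assms(2), of "- 1" x] by simp
qed

lemma topspace_seminorm_topology [simp]: "topspace (seminorm_topology V P) = V"
proof -
  have "openin (seminorm_topology V P) V"
    unfolding openin_seminorm_topology
    by (auto intro!: exI[of _ "{}"] exI[of _ "1::real"])
  then have "V \<subseteq> topspace (seminorm_topology V P)" by (rule openin_subset)
  moreover have "topspace (seminorm_topology V P) \<subseteq> V"
    using openin_topspace[of "seminorm_topology V P"] unfolding openin_seminorm_topology by (rule conjunct1)
  ultimately show ?thesis by simp
qed

text \<open>
  Only differences of points of \<open>V\<close> enter, so on a dual space the hypothesis has to be checked for
  linear functionals alone, not for arbitrary functions.
\<close>

lemma coarser_seminorm_topology:
  assumes "\<And>\<rho> \<epsilon>. \<rho> \<in> P \<Longrightarrow> (\<epsilon>::real) > 0 \<Longrightarrow>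
      \<exists>J \<delta>. finite J \<and> J \<subseteq> P' \<and> (\<delta>::real) > 0 \<and>
        (\<forall>x\<in>V. \<forall>y\<in>V. (\<forall>\<rho>'\<in>J. \<rho>' (y - x) < ennreal \<delta>) \<longrightarrow> \<rho> (y - x) < ennreal \<epsilon>)"
  shows "coarser (seminorm_topology V P) (seminorm_topology V P')"
  unfolding coarser_def
proof (intro allI impI)
  fix U assume U: "openin (seminorm_topology V P) U"
  show "openin (seminorm_topology V P') U"
    unfolding openin_seminorm_topology
  proof (intro conjI ballI)
    show UV: "U \<subseteq> V" using U by (simp add: openin_seminorm_topology)
    fix x assume x: "x \<in> U"
    then obtain J and \<epsilon> :: real where J: "finite J" "J \<subseteq> P" "\<epsilon> > 0"
      and sub: "{y \<in> V. \<forall>\<rho>\<in>J. \<rho> (y - x) < ennreal \<epsilon>} \<subseteq> U"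
      using U unfolding openin_seminorm_topology by blast
    have "\<forall>\<rho>\<in>J. \<exists>K \<delta>. finite K \<and> K \<subseteq> P' \<and> (\<delta>::real) > 0 \<and>
        (\<forall>x\<in>V. \<forall>y\<in>V. (\<forall>\<rho>'\<in>K. \<rho>' (y - x) < ennreal \<delta>) \<longrightarrow> \<rho> (y - x) < ennreal \<epsilon>)"
      using assms J by blast
    then obtain K and \<delta> :: "_ \<Rightarrow> real" where K: "\<forall>\<rho>\<in>J. finite (K \<rho>) \<and> K \<rho> \<subseteq> P' \<and> \<delta> \<rho> > 0 \<and>
        (\<forall>x\<in>V. \<forall>y\<in>V. (\<forall>\<rho>'\<in>K \<rho>. \<rho>' (y - x) < ennreal (\<delta> \<rho>)) \<longrightarrow> \<rho> (y - x) < ennreal \<epsilon>)"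
      by metis
    define d where "d = Min (insert 1 (\<delta> ` J))"
    have d: "d > 0" "\<And>\<rho>. \<rho> \<in> J \<Longrightarrow> d \<le> \<delta> \<rho>"
      using J(1) K by (auto simp: d_def)
    have "{y \<in> V. \<forall>\<rho>'\<in>\<Union>(K ` J). \<rho>' (y - x) < ennreal d} \<subseteq> U"
    proof
      fix y assume y: "y \<in> {y \<in> V. \<forall>\<rho>'\<in>\<Union>(K ` J). \<rho>' (y - x) < ennreal d}"
      have "\<rho> (y - x) < ennreal \<epsilon>" if "\<rho> \<in> J" for \<rho>
      proof -
        have "\<forall>\<rho>'\<in>K \<rho>. \<rho>' (y - x) < ennreal (\<delta> \<rho>)"
          using y that d(2)[OF that] by (auto intro: less_le_trans ennreal_leI)
        then show ?thesis using K that y x UV by blast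
      qed
      then show "y \<in> U" using y sub by blast
    qed
    moreover have "finite (\<Union>(K ` J))" "\<Union>(K ` J) \<subseteq> P'" using J(1) K by auto
    ultimately show "\<exists>J \<epsilon>. finite J \<and> J \<subseteq> P' \<and> (\<epsilon>::real) > 0 \<and>
        {y \<in> V. \<forall>\<rho>\<in>J. \<rho> (y - x) < ennreal \<epsilon>} \<subseteq> U"
      using d(1) by blast
  qed
qed

lemma nhd_zero_seminorm_topologyD:
  fixes P :: "('a::ab_group_add \<Rightarrow> ennreal) set"
  assumes "nhd_zero (seminorm_topology UNIV P) U"
  obtains J and \<epsilon> :: real where "finite J" "J \<subseteq> P" "\<epsilon> > 0" "{y. \<forall>\<rho>\<in>J. \<rho> y < ennreal \<epsilon>} \<subseteq> U"
proof -
  obtain V where V: "openin (seminorm_topology UNIV P) V" "0 \<in> V" "V \<subseteq> U"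
    using assms by (auto simp: nhd_zero_def)
  obtain J and \<epsilon> :: real where "finite J" "J \<subseteq> P" "\<epsilon> > 0"
      "{y \<in> UNIV. \<forall>\<rho>\<in>J. \<rho> (y - 0) < ennreal \<epsilon>} \<subseteq> V"
    using V(1,2) unfolding openin_seminorm_topology by meson
  with V(3) show thesis using that[of J \<epsilon>] by auto
qed

text \<open>
  The set where \<open>\<rho>\<close> is infinite is a union of cosets of the open finite part, so \<open>\<rho>\<close> is constant near an
  infinite value; near a finite value the reverse triangle inequality applies.
\<close>

lemma continuous_ext_seminorm:
  fixes smul :: "'k::real_or_complex \<Rightarrow> 'a::ab_group_add \<Rightarrow> 'a"
  assumes vs: "vector_space smul" and ext: "ext_seminorm smul \<rho>" and mem: "\<rho> \<in> P"
  shows "continuous_map (seminorm_topology UNIV P) euclidean \<rho>"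
  unfolding continuous_map_def
proof (intro conjI allI impI)
  fix W :: "ennreal set" assume "openin euclidean W"
  then have W: "open W" by simp
  \<comment> \<open>Both halves of the reverse triangle inequality, written without subtraction in \<open>[0, \<infinity>]\<close>.\<close>
  have tri: "\<rho> z \<le> \<rho> (y - x) + \<rho> w" if "z = x \<and> w = y \<or> z = y \<and> w = x" for x y z w
    using that ext_seminorm_triangle[OF ext, of "x - y" y]
      ext_seminorm_triangle[OF ext, of "y - x" x] ext_seminorm_minus[OF vs ext, of "x - y"]
    by auto
  show "openin (seminorm_topology UNIV P) {x \<in> topspace (seminorm_topology UNIV P). \<rho> x \<in> W}"
    unfolding openin_seminorm_topology
  proof (intro conjI ballI)
    fix x assume "x \<in> {x \<in> topspace (seminorm_topology UNIV P). \<rho> x \<in> W}"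
    then have x: "\<rho> x \<in> W" by simp
    have "\<exists>\<epsilon>::real. \<epsilon> > 0 \<and> (\<forall>y. \<rho> (y - x) < ennreal \<epsilon> \<longrightarrow> \<rho> y \<in> W)"
    proof (cases "\<rho> x")
      case top
      have "\<rho> y = top" if "\<rho> (y - x) < ennreal 1" for y
      proof (rule ccontr)
        assume "\<rho> y \<noteq> top"
        then have "\<rho> (y - x) + \<rho> y < top"
          using order_less_trans[OF that ennreal_less_top] by (simp add: less_top)
        then show False using tri[of x x y y] top by (auto simp: top_unique)
      qed
      then show ?thesis using x top by (intro exI[of _ 1]) auto
    next
      case (real r)
      have "open (ennreal -` W)"
        using W by (intro open_vimage continuous_on_ennreal continuous_on_id)
      then obtain e where e: "e > 0" "\<And>z. dist z r < e \<Longrightarrow> ennreal z \<in> W"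
        using x real by (force simp: open_dist)
      have "\<rho> y \<in> W" if y: "\<rho> (y - x) < ennreal e" for y
      proof -
        obtain a where a: "\<rho> (y - x) = ennreal a" "a \<ge> 0"
          using y by (cases "\<rho> (y - x)") auto
        have le: "\<rho> y \<le> ennreal (a + r)" using tri[of y x x y] a real by (simp add: add.commute)
        then obtain b where b: "\<rho> y = ennreal b" "b \<ge> 0"
          by (cases "\<rho> y") (auto simp: top_unique)
        have "a < e" using y a by (simp add: ennreal_less_iff)
        moreover have "b \<le> a + r" using le a real unfolding b(1) by (subst (asm) ennreal_le_iff) auto
        moreover have "r \<le> a + b"
          using tri[of x x y y] a b real
          by (simp add: ennreal_plus[symmetric] ennreal_le_iff del: ennreal_plus)
        ultimately have "dist b r < e" by (simp add: dist_real_def)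
        then show ?thesis using e(2) b by simp
      qed
      then show ?thesis using e(1) by blast
    qed
    then show "\<exists>J \<epsilon>. finite J \<and> J \<subseteq> P \<and> 0 < \<epsilon> \<and> {y \<in> UNIV. \<forall>\<rho>\<in>J. \<rho> (y - x) < ennreal \<epsilon>}
        \<subseteq> {x \<in> topspace (seminorm_topology UNIV P). \<rho> x \<in> W}"
      using mem by (elim exE) (rule exI[of _ "{\<rho>}"], auto)
  qed simp
qed auto

section \<open>Bounded sets\<close>

text \<open>
  The seminorms may take the value \<open>\<infinity>\<close> off \<open>B\<close>; this is what allows the lemma to be used for \<open>\<tau>\<close> itself
  on the set \<open>p(B)\<close>.
\<close>

lemma lcs_bounded_seminorm_topology:
  fixes smul :: "'k::real_or_complex \<Rightarrow> 'a::ab_group_add \<Rightarrow> 'a"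
  assumes vs: "vector_space smul" and ext: "\<And>\<rho>. \<rho> \<in> P \<Longrightarrow> ext_seminorm smul \<rho>"
    and bdd: "\<And>\<rho>. \<rho> \<in> P \<Longrightarrow> \<exists>K::real. \<forall>b\<in>B. \<rho> b \<le> ennreal K"
  shows "lcs_bounded smul (seminorm_topology UNIV P) B"
  unfolding lcs_bounded_def
proof (intro allI impI)
  interpret vector_space smul by fact
  fix U assume "nhd_zero (seminorm_topology UNIV P) U"
  then obtain J and \<epsilon> :: real where J: "finite J" "J \<subseteq> P" "\<epsilon> > 0"
      "{y. \<forall>\<rho>\<in>J. \<rho> y < ennreal \<epsilon>} \<subseteq> U"
    by (rule nhd_zero_seminorm_topologyD)
  obtain K :: "_ \<Rightarrow> real" where K: "\<forall>\<rho>\<in>J. \<forall>b\<in>B. \<rho> b \<le> ennreal (K \<rho>)"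
    using bdd J(2) by (metis subsetD)
  define L where "L = Max (insert 1 (K ` J))"
  have L: "L > 0" "\<And>\<rho>. \<rho> \<in> J \<Longrightarrow> K \<rho> \<le> L" using J(1) by (auto simp: L_def)
     (meson Max_ge finite_imageI finite_insert insertI1 less_le_trans zero_less_one)
  \<comment> \<open>The factor 2 makes the scaled seminorms strictly smaller than \<open>\<epsilon>\<close>.\<close>
  define r where "r = 2 * L / \<epsilon>"
  have r: "r > 0" using L J by (simp add: r_def)
  have "b \<in> smul (of_real r) ` U" if b: "b \<in> B" for b
  proof
    show "b = smul (of_real r) (smul (of_real (1 / r)) b)" using r by simp
    have "\<rho> (smul (of_real (1 / r)) b) < ennreal \<epsilon>" if "\<rho> \<in> J" for \<rho>
    proof -
      have "\<rho> (smul (of_real (1 / r)) b) = ennreal (1 / r) * \<rho> b"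
        using that J(2) ext r by (simp add: ext_seminorm_scale[OF ext] subsetD norm_divide)
      also have "\<dots> \<le> ennreal (1 / r) * ennreal L"
        using K that b order_trans[OF _ ennreal_leI[OF L(2)[OF that]]] by (intro mult_left_mono) auto
      also have "\<dots> = ennreal (\<epsilon> / 2)"
        using L r J by (simp add: ennreal_mult''[symmetric] r_def)
      also have "\<dots> < ennreal \<epsilon>" using J by (simp add: ennreal_less_iff)
      finally show ?thesis .
    qed
    then show "smul (of_real (1 / r)) b \<in> U" using J(4) by blast
  qed
  then show "\<exists>r::real. r > 0 \<and> B \<subseteq> smul (of_real r) ` U" using r by blast
qed

text \<open>
  The topology of the single seminorm \<open>\<sigma>\<close> is locally convex and coarser than \<open>\<tau>\<close>, hence coarser than
  \<open>\<tau>\<^sub>F\<close> by maximality, so the unit ball of \<open>\<sigma>\<close> is a \<open>\<tau>\<^sub>F\<close>-neighbourhood of \<open>0\<close> and absorbs \<open>B\<close>.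
\<close>

lemma lcs_bounded_flc_imp_bounded:
  fixes smul :: "'k::real_or_complex \<Rightarrow> 'a::ab_group_add \<Rightarrow> 'a"
  assumes elcs: "elcs smul \<tau>" and B: "lcs_bounded smul (flc_topology smul \<tau>) B"
    and ext: "ext_seminorm smul \<sigma>" and fin: "\<And>x. \<sigma> x < \<infinity>"
    and nhd: "\<And>\<epsilon>::real. \<epsilon> > 0 \<Longrightarrow> nhd_zero \<tau> {x. \<sigma> x < ennreal \<epsilon>}"
  shows "\<exists>K::real. \<forall>b\<in>B. \<sigma> b \<le> ennreal K"
proof -
  obtain Q where vs: "vector_space smul" and tau: "\<tau> = seminorm_topology UNIV Q"
    using elcs by (auto simp: elcs_def)
  let ?T = "seminorm_topology UNIV {\<sigma>}"
  have "locally_convex_topology smul ?T"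
    unfolding locally_convex_topology_def using ext fin by blast
  moreover have "coarser ?T \<tau>"
    unfolding tau
  proof (rule coarser_seminorm_topology)
    fix \<rho> and \<epsilon> :: real assume "\<rho> \<in> {\<sigma>}" "\<epsilon> > 0"
    then obtain J and \<delta> :: real where "finite J" "J \<subseteq> Q" "\<delta> > 0"
        "{y. \<forall>\<rho>\<in>J. \<rho> y < ennreal \<delta>} \<subseteq> {x. \<rho> x < ennreal \<epsilon>}"
      using nhd[of \<epsilon>] unfolding tau by (auto elim: nhd_zero_seminorm_topologyD)
    then show "\<exists>J \<delta>. finite J \<and> J \<subseteq> Q \<and> (\<delta>::real) > 0 \<and> (\<forall>x\<in>UNIV. \<forall>y\<in>UNIV.
        (\<forall>\<rho>'\<in>J. \<rho>' (y - x) < ennreal \<delta>) \<longrightarrow> \<rho> (y - x) < ennreal \<epsilon>)"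
      by (intro exI[of _ J] exI[of _ \<delta>]) auto
  qed
  ultimately have co: "coarser ?T (flc_topology smul \<tau>)"
    using is_flc_topology_flc_topology[OF elcs] by (simp add: is_flc_topology_def)
  have "openin ?T {x \<in> topspace ?T. \<sigma> x \<in> {..<ennreal 1}}"
    by (rule openin_continuous_map_preimage[OF continuous_ext_seminorm[OF vs ext]]) auto
  then have "openin (flc_topology smul \<tau>) {x. \<sigma> x < ennreal 1}"
    using co by (simp add: coarser_def)
  then have "nhd_zero (flc_topology smul \<tau>) {x. \<sigma> x < ennreal 1}"
    unfolding nhd_zero_def using ext_seminorm_zero[OF vs ext]
    by (intro exI[of _ "{x. \<sigma> x < ennreal 1}"]) auto
  then obtain r :: real where r: "r > 0" "B \<subseteq> smul (of_real r) ` {x. \<sigma> x < ennreal 1}"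
    using B unfolding lcs_bounded_def by blast
  have "\<sigma> b \<le> ennreal r" if "b \<in> B" for b
  proof -
    have "b \<in> smul (of_real r) ` {x. \<sigma> x < ennreal 1}" using r(2) that by (rule subsetD)
    then obtain x where x: "b = smul (of_real r) x" "\<sigma> x < ennreal 1" by auto
    then have "\<sigma> b \<le> ennreal r * ennreal 1"
      using r(1) by (simp only: x(1) ext_seminorm_scale[OF ext]) (intro mult_mono, auto)
    then show ?thesis by simp
  qed
  then show ?thesis by blast
qed

text \<open>
  If \<open>\<sigma>\<close> is finite and \<open>B \<subseteq> F + r \<cdot> {\<sigma> < 1}\<close> with \<open>F\<close> finite, then \<open>\<sigma>\<close> is at most \<open>r\<close> plus the sum of its values on \<open>F\<close>.
\<close>

lemma elcs_bounded_imp_lcs_bounded_flc: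
  fixes smul :: "'k::real_or_complex \<Rightarrow> 'a::ab_group_add \<Rightarrow> 'a"
  assumes elcs: "elcs smul \<tau>" and B: "elcs_bounded smul \<tau> B"
  shows "lcs_bounded smul (flc_topology smul \<tau>) B"
proof -
  have vs: "vector_space smul" using elcs by (simp add: elcs_def)
  obtain R where R: "\<And>\<sigma>. \<sigma> \<in> R \<Longrightarrow> ext_seminorm smul \<sigma>" "\<And>\<sigma> x. \<sigma> \<in> R \<Longrightarrow> \<sigma> x < \<infinity>"
    and flc: "flc_topology smul \<tau> = seminorm_topology UNIV R"
    and co: "coarser (seminorm_topology UNIV R) \<tau>"
    using is_flc_topology_flc_topology[OF elcs]
    unfolding is_flc_topology_def locally_convex_topology_def by metis
  show ?thesis
    unfolding flc
  proof (rule lcs_bounded_seminorm_topology[OF vs R(1)])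
    fix \<sigma> assume s: "\<sigma> \<in> R"
    let ?T = "seminorm_topology UNIV R"
    have "openin ?T {x \<in> topspace ?T. \<sigma> x \<in> {..<ennreal 1}}"
      by (rule openin_continuous_map_preimage[OF continuous_ext_seminorm[OF vs R(1)[OF s] s]]) auto
    then have "openin \<tau> {x. \<sigma> x < ennreal 1}"
      using co by (simp add: coarser_def)
    then have "nhd_zero \<tau> {x. \<sigma> x < ennreal 1}"
      unfolding nhd_zero_def using ext_seminorm_zero[OF vs R(1)[OF s]]
      by (intro exI[of _ "{x. \<sigma> x < ennreal 1}"]) auto
    then obtain r :: real and F where r: "r > 0" "finite F"
        "B \<subseteq> {x + smul (of_real r) u | x u. x \<in> F \<and> u \<in> {x. \<sigma> x < ennreal 1}}"
      using B unfolding elcs_bounded_def by meson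
    define K where "K = (\<Sum>x\<in>F. enn2real (\<sigma> x)) + r"
    have "\<sigma> b \<le> ennreal K" if bB: "b \<in> B" for b
    proof -
      obtain x u where xu: "b = x + smul (of_real r) u" "x \<in> F" "\<sigma> u < ennreal 1"
        using subsetD[OF r(3) bB] by auto
      have "\<sigma> x = ennreal (enn2real (\<sigma> x))" using R(2)[OF s, of x] by simp
      also have "\<dots> \<le> ennreal (\<Sum>x\<in>F. enn2real (\<sigma> x))"
        using xu(2) r(2) by (intro ennreal_leI member_le_sum) auto
      finally have x: "\<sigma> x \<le> ennreal (\<Sum>x\<in>F. enn2real (\<sigma> x))" .
      have "\<sigma> (smul (of_real r) u) \<le> ennreal r * ennreal 1"
        using r(1) xu(3) by (simp only: ext_seminorm_scale[OF R(1)[OF s]]) (intro mult_mono, auto)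
      then have "\<sigma> b \<le> ennreal (\<Sum>x\<in>F. enn2real (\<sigma> x)) + ennreal r"
        unfolding xu(1) using ext_seminorm_triangle[OF R(1)[OF s], of x "smul (of_real r) u"] x
        by (auto intro: order_trans add_mono)
      also have "\<dots> = ennreal K"
        unfolding K_def using r(1) by (intro ennreal_plus[symmetric] sum_nonneg) auto
      finally show ?thesis .
    qed
    then show "\<exists>K::real. \<forall>b\<in>B. \<sigma> b \<le> ennreal K" by blast
  qed
qed

text \<open>
  The finite set of translates in the definition of boundedness must be taken inside the set, which
  is why \<open>0\<close> is adjoined: it serves as the translate for the points of \<open>A\<close>.
\<close>

lemma elcs_bounded_Un_finite:
  fixes smul :: "'k::real_or_complex \<Rightarrow> 'a::ab_group_add \<Rightarrow> 'a"
  assumes vs: "vector_space smul" and A: "lcs_bounded smul \<tau> A" and F: "finite F" "0 \<in> F"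
  shows "elcs_bounded smul \<tau> (A \<union> F)"
  unfolding elcs_bounded_def
proof (intro allI impI)
  interpret vector_space smul by fact
  fix U assume U: "nhd_zero \<tau> U"
  then obtain r :: real where r: "r > 0" "A \<subseteq> smul (of_real r) ` U"
    using A unfolding lcs_bounded_def by blast
  have "0 \<in> U" using U by (auto simp: nhd_zero_def)
  have "b \<in> {x + smul (of_real r) u | x u. x \<in> F \<and> u \<in> U}" if "b \<in> A \<union> F" for b
  proof (cases "b \<in> F")
    case True
    have "b = b + smul (of_real r) 0" by simp
    with True \<open>0 \<in> U\<close> show ?thesis by blast
  next
    case False
    then have "b \<in> smul (of_real r) ` U" using that r(2) by blast
    then obtain u where "u \<in> U" "b = 0 + smul (of_real r) u" by auto
    with F(2) show ?thesis by blast
  qed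
  then show "\<exists>r F'. 0 < (r::real) \<and> finite F' \<and> F' \<subseteq> A \<union> F \<and>
      A \<union> F \<subseteq> {x + smul (of_real r) u | x u. x \<in> F' \<and> u \<in> U}"
    using r(1) F(1) by (intro exI[of _ r] exI[of _ F]) auto
qed

section \<open>Sets on which every linear functional is bounded\<close>

lemma vector_space_field: "vector_space ((*) :: 'k::field \<Rightarrow> 'k \<Rightarrow> 'k)"
  by unfold_locales (auto simp: algebra_simps)

text \<open>
  In effect, a set bounded for the finest locally convex topology is finite-dimensional. Take for \<open>E\<close>
  a maximal independent subset of \<open>C\<close>. Were it infinite, some linear functional would take the values
  \<open>0, 1, 2, \<dots>\<close> on a sequence in \<open>E\<close>. Being finite, it has finitely many coordinate functionals, which
  are bounded on \<open>C\<close> by a common \<open>L\<close>.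
\<close>

lemma bounded_functionals_imp_finite_dim:
  fixes smul :: "'k::real_or_complex \<Rightarrow> 'a::ab_group_add \<Rightarrow> 'a"
  assumes vs: "vector_space smul"
    and bdd: "\<And>g. Vector_Spaces.linear smul (*) g \<Longrightarrow> \<exists>K::real. \<forall>c\<in>C. norm (g c) \<le> K"
  obtains E and L :: real where "finite E" "L > 0"
    "\<And>f c. Vector_Spaces.linear smul (*) f \<Longrightarrow> c \<in> C \<Longrightarrow> norm (f c) \<le> L * (\<Sum>e\<in>E. norm (f e))"
proof -
  interpret vector_space_pair smul "(*) :: 'k \<Rightarrow> 'k \<Rightarrow> 'k"
    unfolding vector_space_pair_def using vs vector_space_field by blast
  obtain E where E: "E \<subseteq> C" "vs1.independent E" "C \<subseteq> vs1.span E"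
    by (rule vs1.maximal_independent_subset)
  have fin: "finite E"
  proof (rule ccontr)
    assume "\<not> finite E"
    then obtain s :: "nat \<Rightarrow> 'a" where s: "inj s" "range s \<subseteq> E"
      using infinite_countable_subset by blast
    obtain g where g: "Vector_Spaces.linear smul (*) g" "\<forall>x\<in>E. g x = of_nat (inv s x)"
      using linear_independent_extend[OF E(2), of "\<lambda>x. of_nat (inv s x)"] by blast
    obtain K where K: "\<forall>c\<in>C. norm (g c) \<le> K" using bdd[OF g(1)] by blast
    obtain n :: nat where n: "real n > K" using reals_Archimedean2 by blast
    have "s n \<in> E" using s(2) by blast
    then have "norm (g (s n)) = real n" using g(2) s(1) by simp
    with K n \<open>s n \<in> E\<close> E(1) show False by (metis not_le subsetD)
  qed
  have "\<forall>e. \<exists>g. Vector_Spaces.linear smul (*) g \<and> (\<forall>x\<in>E. g x = (if x = e then 1 else 0))"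
    using linear_independent_extend[OF E(2)] by auto
  then obtain g where g: "\<And>e. Vector_Spaces.linear smul (*) (g e)"
      "\<And>e x. x \<in> E \<Longrightarrow> g e x = (if x = e then 1 else 0)" by metis
  obtain K :: "'a \<Rightarrow> real" where K: "\<And>e c. c \<in> C \<Longrightarrow> norm (g e c) \<le> K e"
    using bdd[OF g(1)] by metis
  define L where "L = Max (insert 1 (K ` E))"
  have L: "L \<ge> 1" "\<And>e. e \<in> E \<Longrightarrow> K e \<le> L" using fin by (auto simp: L_def)
  show thesis
  proof (rule that[OF fin, of L])
    show "L > 0" using L(1) by simp
    fix f c assume f: "Vector_Spaces.linear smul (*) f" and c: "c \<in> C"
    \<comment> \<open>Both sides are linear in \<open>c\<close> and agree on \<open>E\<close>, which spans \<open>C\<close>.\<close>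
    have "f c = (\<Sum>e\<in>E. f e * g e c)"
    proof (rule linear_eq_on[OF f])
      show "Vector_Spaces.linear smul (*) (\<lambda>x. \<Sum>e\<in>E. f e * g e x)"
        using g(1) by (intro linear_compose_sum ballI linear_compose_scale_right)
      show "c \<in> vs1.span E" using c E by blast
      show "f b = (\<Sum>e\<in>E. f e * g e b)" if "b \<in> E" for b
        using that fin by (simp add: g(2) if_distrib sum.delta cong: if_cong)
    qed
    then have "norm (f c) \<le> (\<Sum>e\<in>E. norm (f e) * norm (g e c))"
      by (simp add: norm_mult[symmetric] norm_sum)
    also have "\<dots> \<le> (\<Sum>e\<in>E. norm (f e) * L)"
      using K[OF c] L(2) by (intro sum_mono mult_left_mono) (auto intro: order_trans)
    finally show "norm (f c) \<le> L * (\<Sum>e\<in>E. norm (f e))"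
      by (simp add: sum_distrib_left mult.commute)
  qed
qed

section \<open>The projection along the complement\<close>

lemma ext_seminorm_finite_subspace:
  fixes smul :: "'k::real_or_complex \<Rightarrow> 'a::ab_group_add \<Rightarrow> 'a"
  assumes vs: "vector_space smul" and ext: "\<And>\<rho>. \<rho> \<in> S \<Longrightarrow> ext_seminorm smul \<rho>"
  shows "module.subspace smul (\<Inter>\<rho>\<in>S. fin_part \<rho>)"
proof -
  interpret vector_space smul by fact
  show ?thesis
  proof (rule subspaceI)
    fix x y c assume x: "x \<in> (\<Inter>\<rho>\<in>S. fin_part \<rho>)"
    then show "smul c x \<in> (\<Inter>\<rho>\<in>S. fin_part \<rho>)"
      by (auto simp: fin_part_def ext_seminorm_scale[OF ext] ennreal_mult_less_top)
    assume y: "y \<in> (\<Inter>\<rho>\<in>S. fin_part \<rho>)"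
    have "\<rho> (x + y) < top" if "\<rho> \<in> S" for \<rho>
      using ext_seminorm_triangle[OF ext[OF that], of x y] x y that
      by (auto simp: fin_part_def intro: le_less_trans)
    then show "x + y \<in> (\<Inter>\<rho>\<in>S. fin_part \<rho>)"
      by (auto simp: fin_part_def)
  qed (auto simp: fin_part_def ext_seminorm_zero[OF vs ext])
qed

lemma complemented_subspace_projection:
  assumes vs: "vector_space smul"
    and N: "module.subspace smul N" and M: "module.subspace smul M"
    and int: "N \<inter> M = {0}" and sum: "{x + m | x m. x \<in> N \<and> m \<in> M} = UNIV"
  obtains p where "Vector_Spaces.linear smul smul p" "\<And>x. p x \<in> N" "\<And>x. x \<in> N \<Longrightarrow> p x = x"
proof -
  interpret vector_space smul by fact
  have "\<forall>x. \<exists>n. n \<in> N \<and> x - n \<in> M"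
  proof
    fix x
    have "x \<in> {x + m | x m. x \<in> N \<and> m \<in> M}" using sum by simp
    then obtain n m where "x = n + m" "n \<in> N" "m \<in> M" by blast
    then show "\<exists>n. n \<in> N \<and> x - n \<in> M" by (intro exI[of _ n]) simp
  qed
  then obtain p where p: "\<And>x. p x \<in> N" "\<And>x. x - p x \<in> M" by metis
  have unique: "p x = n" if "n \<in> N" "x - n \<in> M" for x n
  proof -
    have "p x - n \<in> N" using subspace_diff[OF N p(1) that(1)] .
    moreover have "p x - n \<in> M" using subspace_diff[OF M that(2) p(2)[of x]] by simp
    ultimately have "p x - n \<in> N \<inter> M" by (rule IntI)
    then show ?thesis unfolding int by simp
  qed
  have "p (x + y) = p x + p y" for x y
  proof (rule unique)
    show "p x + p y \<in> N" using subspace_add[OF N p(1) p(1)] .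
    show "x + y - (p x + p y) \<in> M"
      using subspace_add[OF M p(2) p(2), of x y] by (simp add: algebra_simps)
  qed
  moreover have "p (smul c x) = smul c (p x)" for c x
  proof (rule unique)
    show "smul c (p x) \<in> N" using subspace_scale[OF N p(1)] .
    show "smul c x - smul c (p x) \<in> M"
      using subspace_scale[OF M p(2), of c x] by (simp add: scale_right_diff_distrib)
  qed
  ultimately have "Vector_Spaces.linear smul smul p"
    using vs by (simp add: Vector_Spaces.linear_iff)
  moreover have "p x = x" if "x \<in> N" for x
    using unique[of x x] that subspace_0[OF M] by simp
  ultimately show thesis by (rule that[OF _ p(1)])
qed

section \<open>Comparison of bounded sets and of the topologies on the dual\<close>

text \<open>
  Fundamentality enters through the openness of \<open>X\<^sub>f\<^sub>i\<^sub>n\<close>, which makes the seminorms \<open>\<rho> \<circ> p\<close> and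
  \<open>\<bar>g \<circ> (id - p)\<bar>\<close> continuous. The bound holds for all linear functionals \<open>f\<close>, with a constant that does
  not depend on \<open>f\<close>: a point of \<open>B\<close> contributes one point of \<open>p(B)\<close>, and at most \<open>L\<close> times the sum of \<open>\<bar>f\<bar>\<close>
  over \<open>E\<close>.
\<close>

lemma lcs_bounded_flc_dominated:
  fixes smul :: "'k::real_or_complex \<Rightarrow> 'a::ab_group_add \<Rightarrow> 'a"
  assumes elcs: "elcs smul \<tau>" and fund: "fundamental smul \<tau>"
    and M: "module.subspace smul M" and int: "fin_subspace smul \<tau> \<inter> M = {0}"
    and sum: "{x + m | x m. x \<in> fin_subspace smul \<tau> \<and> m \<in> M} = UNIV"
    and B: "lcs_bounded smul (flc_topology smul \<tau>) B"
  obtains B' and C :: real where "elcs_bounded smul \<tau> B'" "C > 0"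
    "\<And>f. Vector_Spaces.linear smul (*) f \<Longrightarrow> sup_seminorm B f \<le> ennreal C * sup_seminorm B' f"
proof -
  obtain Q where vs: "vector_space smul" and Q: "\<And>\<rho>. \<rho> \<in> Q \<Longrightarrow> ext_seminorm smul \<rho>"
    and tau: "\<tau> = seminorm_topology UNIV Q"
    using elcs by (auto simp: elcs_def)
  interpret vector_space smul by fact
  let ?N = "fin_subspace smul \<tau>"
  have cont: "\<rho> \<in> cont_ext_seminorms smul \<tau>" if "\<rho> \<in> Q" for \<rho>
    using that continuous_ext_seminorm[OF vs Q] Q by (auto simp: cont_ext_seminorms_def tau)
  have top: "topspace \<tau> = UNIV" by (simp add: tau)
  have openN: "openin \<tau> ?N"
  proof -
    obtain \<rho> where "continuous_map \<tau> euclidean \<rho>" and N: "?N = fin_part \<rho>"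
      using fund by (auto simp: fundamental_def cont_ext_seminorms_def)
    then have "openin \<tau> {x \<in> topspace \<tau>. \<rho> x \<in> {..<\<infinity>}}"
      by (intro openin_continuous_map_preimage) auto
    then show ?thesis by (simp add: N fin_part_def top)
  qed
  have N: "module.subspace smul ?N"
    unfolding fin_subspace_def
    by (rule ext_seminorm_finite_subspace[OF vs]) (simp add: cont_ext_seminorms_def)
  then have "0 \<in> ?N" by (rule subspace_0)
  obtain p where lp: "Vector_Spaces.linear smul smul p" and pN: "\<And>x. p x \<in> ?N"
    and pid: "\<And>x. x \<in> ?N \<Longrightarrow> p x = x"
    by (rule complemented_subspace_projection[OF vs N M int sum]) blast
  interpret p: Vector_Spaces.linear smul smul p by (rule lp)
  have p_bdd: "lcs_bounded smul \<tau> (p ` B)"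
    unfolding tau
  proof (rule lcs_bounded_seminorm_topology[OF vs Q])
    fix \<rho> assume r: "\<rho> \<in> Q"
    have "\<exists>K::real. \<forall>b\<in>B. (\<lambda>x. \<rho> (p x)) b \<le> ennreal K"
    proof (rule lcs_bounded_flc_imp_bounded[OF elcs B])
      show "ext_seminorm smul (\<lambda>x. \<rho> (p x))"
        using Q[OF r] by (auto simp: ext_seminorm_def p.add p.scale)
      show "\<rho> (p x) < \<infinity>" for x
        using pN[of x] cont[OF r] by (auto simp: fin_subspace_def fin_part_def)
      fix \<epsilon> :: real assume e: "\<epsilon> > 0"
      have "openin \<tau> {x \<in> topspace \<tau>. \<rho> x \<in> {..<ennreal \<epsilon>}}"
        using cont[OF r] by (intro openin_continuous_map_preimage) (auto simp: cont_ext_seminorms_def)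
      then have "openin \<tau> (?N \<inter> {x. \<rho> x < ennreal \<epsilon>})" using openN by (simp add: top openin_Int)
      moreover have "?N \<inter> {x. \<rho> x < ennreal \<epsilon>} \<subseteq> {x. \<rho> (p x) < ennreal \<epsilon>}"
        using pid by auto
      moreover have "0 \<in> ?N \<inter> {x. \<rho> x < ennreal \<epsilon>}"
        using e \<open>0 \<in> ?N\<close> by (simp add: ext_seminorm_zero[OF vs Q[OF r]])
      ultimately show "nhd_zero \<tau> {x. \<rho> (p x) < ennreal \<epsilon>}"
        unfolding nhd_zero_def by blast
    qed
    then show "\<exists>K::real. \<forall>c\<in>p ` B. \<rho> c \<le> ennreal K" by simp
  qed simp
  have q_bdd: "\<exists>K::real. \<forall>c\<in>(\<lambda>b. b - p b) ` B. norm (g c) \<le> K"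
    if g: "Vector_Spaces.linear smul (*) g" for g :: "'a \<Rightarrow> 'k"
  proof -
    interpret g: Vector_Spaces.linear smul "(*)" g by (rule g)
    have "\<exists>K::real. \<forall>b\<in>B. (\<lambda>x. ennreal (norm (g (x - p x)))) b \<le> ennreal K"
    proof (rule lcs_bounded_flc_imp_bounded[OF elcs B])
      have "g (x + y - p (x + y)) = g (x - p x) + g (y - p y)" for x y
        by (simp add: p.add g.add g.diff)
      moreover have "g (smul c x - p (smul c x)) = c * g (x - p x)" for c x
        by (simp add: p.scale g.scale g.diff right_diff_distrib)
      ultimately show "ext_seminorm smul (\<lambda>x. ennreal (norm (g (x - p x))))"
        by (simp add: ext_seminorm_def norm_mult ennreal_mult' norm_triangle_ineq
            flip: ennreal_plus)
      show "nhd_zero \<tau> {x. ennreal (norm (g (x - p x))) < ennreal \<epsilon>}" if "\<epsilon> > 0" for \<epsilon> :: real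
        unfolding nhd_zero_def
        by (rule exI[of _ ?N]) (use openN \<open>0 \<in> ?N\<close> pid that in \<open>auto simp: g.zero\<close>)
    qed simp
    then obtain K :: real where K: "\<forall>b\<in>B. ennreal (norm (g (b - p b))) \<le> ennreal K" by blast
    have "norm (g (b - p b)) \<le> max K 0" if "b \<in> B" for b
      using K that by (auto simp: ennreal_le_iff2)
    then show ?thesis by blast
  qed
  obtain E and L :: real where E: "finite E" and L: "L > 0"
    and q_le: "\<And>f c. Vector_Spaces.linear smul (*) f \<Longrightarrow> c \<in> (\<lambda>b. b - p b) ` B \<Longrightarrow>
      norm (f c) \<le> L * (\<Sum>e\<in>E. norm (f e))"
    using bounded_functionals_imp_finite_dim[OF vs q_bdd] by blast
  let ?B = "p ` B \<union> insert 0 E"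
  define C where "C = 1 + L * card E"
  show thesis
  proof (rule that[of ?B C])
    show "elcs_bounded smul \<tau> ?B"
      by (rule elcs_bounded_Un_finite[OF vs p_bdd]) (use E in auto)
    show C: "C > 0" unfolding C_def using L by (intro add_pos_nonneg) auto
    fix f assume f: "Vector_Spaces.linear smul (*) f"
    interpret f: Vector_Spaces.linear smul "(*)" f by (rule f)
    let ?s = "sup_seminorm ?B f"
    have up: "ennreal (norm (f x)) \<le> ?s" if "x \<in> ?B" for x
      unfolding sup_seminorm_def using that by (rule SUP_upper)
    show "sup_seminorm B f \<le> ennreal C * ?s"
    proof (cases ?s)
      case top
      then show ?thesis using C by (simp add: ennreal_mult_top)
    next
      case (real s)
      have le: "norm (f x) \<le> s" if "x \<in> ?B" for x
        using up[OF that] real by (simp add: ennreal_le_iff)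
      have "norm (f b) \<le> C * s" if b: "b \<in> B" for b
      proof -
        have "norm (f b) = norm (f (p b) + f (b - p b))" by (simp add: f.diff)
        also have "\<dots> \<le> norm (f (p b)) + norm (f (b - p b))" by (rule norm_triangle_ineq)
        also have "norm (f (p b)) \<le> s" using b by (intro le) auto
        also have "norm (f (b - p b)) \<le> L * (\<Sum>e\<in>E. norm (f e))" using b by (intro q_le[OF f]) auto
        also have "(\<Sum>e\<in>E. norm (f e)) \<le> card E * s"
          using sum_bounded_above[of E "\<lambda>e. norm (f e)" s] le by simp
        finally show ?thesis using L by (simp add: C_def algebra_simps mult_left_mono)
      qed
      then show ?thesis
        unfolding real(2) sup_seminorm_def[of B] using C real(1)
        by (intro SUP_least) (simp add: ennreal_mult'[symmetric] ennreal_leI)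
    qed
  qed
qed

theorem theorem5p7:
  fixes smul :: "'k::real_or_complex \<Rightarrow> 'a::ab_group_add \<Rightarrow> 'a"
    and \<tau> :: "'a topology"
    and M :: "'a set"
  assumes "elcs smul \<tau>"
    and "fundamental smul \<tau>"
    and "module.subspace smul M"
    and "fin_subspace smul \<tau> \<inter> M = {0}"
    and "{x + m | x m. x \<in> fin_subspace smul \<tau> \<and> m \<in> M} = UNIV"
  shows "ucb_topology smul \<tau> = strong_topology smul \<tau>"
proof -
  have "coarser (ucb_topology smul \<tau>) (strong_topology smul \<tau>)"
    unfolding ucb_topology_def strong_topology_def
  proof (rule coarser_seminorm_topology)
    fix \<rho> :: "('a \<Rightarrow> 'k) \<Rightarrow> ennreal" and \<epsilon> :: real
    assume "\<rho> \<in> sup_seminorm ` {B. elcs_bounded smul \<tau> B}" "\<epsilon> > 0"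
    then show "\<exists>J \<delta>. finite J \<and> J \<subseteq> sup_seminorm ` {B. lcs_bounded smul (flc_topology smul \<tau>) B}
        \<and> (\<delta>::real) > 0 \<and> (\<forall>f\<in>top_dual smul \<tau>. \<forall>g\<in>top_dual smul \<tau>.
          (\<forall>\<rho>'\<in>J. \<rho>' (g - f) < ennreal \<delta>) \<longrightarrow> \<rho> (g - f) < ennreal \<epsilon>)"
      using elcs_bounded_imp_lcs_bounded_flc[OF assms(1)]
      by (intro exI[of _ "{\<rho>}"] exI[of _ \<epsilon>]) auto
  qed
  moreover have "coarser (strong_topology smul \<tau>) (ucb_topology smul \<tau>)"
    unfolding ucb_topology_def strong_topology_def
  proof (rule coarser_seminorm_topology)
    fix \<rho> :: "('a \<Rightarrow> 'k) \<Rightarrow> ennreal" and \<epsilon> :: real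
    assume "\<rho> \<in> sup_seminorm ` {B. lcs_bounded smul (flc_topology smul \<tau>) B}" and e: "\<epsilon> > 0"
    then obtain B where \<rho>: "\<rho> = sup_seminorm B"
      and B: "lcs_bounded smul (flc_topology smul \<tau>) B" by blast
    obtain B' and C :: real where B': "elcs_bounded smul \<tau> B'" and C: "C > 0"
      and le: "\<And>f. Vector_Spaces.linear smul (*) f \<Longrightarrow>
        sup_seminorm B f \<le> ennreal C * sup_seminorm B' f"
      by (rule lcs_bounded_flc_dominated[OF assms B]) blast
    have "\<rho> (g - f) < ennreal \<epsilon>"
      if fg: "f \<in> top_dual smul \<tau>" "g \<in> top_dual smul \<tau>"
        and lt: "sup_seminorm B' (g - f) < ennreal (\<epsilon> / C)" for f g
    proof -
      have "Vector_Spaces.linear smul (*) (g - f)"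
        using fg by (auto simp: top_dual_def Vector_Spaces.linear_iff algebra_simps)
      then have "\<rho> (g - f) \<le> ennreal C * sup_seminorm B' (g - f)" unfolding \<rho> by (rule le)
      also have "\<dots> < ennreal C * ennreal (\<epsilon> / C)"
        using lt C by (intro ennreal_mult_strict_left_mono) auto
      also have "\<dots> = ennreal \<epsilon>" using C e by (simp add: ennreal_mult'[symmetric])
      finally show ?thesis .
    qed
    then show "\<exists>J \<delta>. finite J \<and> J \<subseteq> sup_seminorm ` {B. elcs_bounded smul \<tau> B}
        \<and> (\<delta>::real) > 0 \<and> (\<forall>f\<in>top_dual smul \<tau>. \<forall>g\<in>top_dual smul \<tau>.
          (\<forall>\<rho>'\<in>J. \<rho>' (g - f) < ennreal \<delta>) \<longrightarrow> \<rho> (g - f) < ennreal \<epsilon>)"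
      using B' C e by (intro exI[of _ "{sup_seminorm B'}"] exI[of _ "\<epsilon> / C"]) auto
  qed
  ultimately show ?thesis
    unfolding coarser_def topology_eq by blast
qed

end
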